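(* Let $K$ be a field, $n$ a positive integer, $G$ a simple graph on the vertex set $[n]=\{1,2,\ldots,n\}$, $S=K[X_i,Y_i\mid 1\le i\le n]$, and $I_G=\left([i,j]\mid \{i,j\}\text{ is an edge of }G\right)\subset S$, where $[i,j]=X_iY_j-Y_iX_j$. Then the set $$\mathcal{G}=\{g_P\mid P\text{ is an irreducible path of }G\}$$ is the reduced Gröbner basis of $I_G$ with respect to the reverse lexicographic order on $S$ with $Y_1>Y_2>\cdots>Y_n>X_1>X_2>\cdots>X_n$.
   Context: The reverse lexicographic order means the (graded) reverse lexicographic monomial order: a monomial $u$ is greater than $v$ if $\deg u>\deg v$, or if $\deg u=\deg v$ and, for the smallest variable whose exponents in $u$ and $v$ differ, the exponent in $u$ is smaller. A simple graph has no loops and no multiple edges. A walk of $G$ is a sequence of vertices $P=p_0p_1\ldots p_\ell$ such that $\{p_{i-1},p_i\}$ is an edge of $G$ for $i=1,\ldots,\ell$, and such that $p_0\le p_\ell$. It is a path if moreover the vertices $p_0,\ldots,p_\ell$ are pairwise distinct; $\ell$ is its length. Paths considered in the definition of $\mathcal{G}$ have length $\ell\ge 1$ (so $p_0<p_\ell$). For a path $P=p_0p_1\ldots p_\ell$, the set of joints is $J(P)=\{p_i\mid 0<i<\ell\}$. For walks $P=p_0\ldots p_\ell$ and $Q=q_0\ldots q_m$ write $P\le Q$ if there are indices $0=j_0<j_1<\cdots<j_\ell=m$ with $q_{j_i}=p_i$ for all $i$. A walk is minimal if it is minimal for this order; equivalently, it is a path and no edge of $G$ joins two vertices of $P$ that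 are not consecutive in $P$ (i.e. $P$ is an induced path). A minimal path $P=p_0p_1\ldots p_\ell$ is irreducible if no joint $p\in J(P)$ satisfies $p_0<p<p_\ell$ (comparison of integers). For an irreducible path $P=p_0p_1\ldots p_\ell$ set $g_P=M_P\cdot[p_0,p_\ell]$, where $M_P=\prod_{p\in J(P)}Z_p$, with $Z_p=Y_p$ if $p<p_0$ and $Z_p=X_p$ if $p>p_\ell$. *)

theory Defs
  imports "HOL-Library.Poly_Mapping" "HOL-Algebra.Ideal"
begin

subsection \<open>Polynomials in the variables \<open>X\<^sub>i\<close>, \<open>Y\<^sub>i\<close>\<close>

datatype var = VX nat | VY nat

type_synonym monom = "var \<Rightarrow>\<^sub>0 nat"
type_synonym 'k xypoly = "monom \<Rightarrow>\<^sub>0 'k"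

definition X :: "nat \<Rightarrow> 'k::field xypoly" where
  "X i = Poly_Mapping.single (Poly_Mapping.single (VX i) 1) 1"

definition Y :: "nat \<Rightarrow> 'k::field xypoly" where
  "Y i = Poly_Mapping.single (Poly_Mapping.single (VY i) 1) 1"

text \<open>The type \<^typ>\<open>'k xypoly\<close> has infinitely many variables; \<open>K[X\<^sub>i, Y\<^sub>i | 1 \<le> i \<le> n]\<close> is the
  subring of those polynomials in which only variables with index in \<open>{1..n}\<close> occur.\<close>

definition S :: "nat \<Rightarrow> 'k::field xypoly ring" where
  "S n = \<lparr>carrier = {f. \<forall>m \<in> Poly_Mapping.keys f. Poly_Mapping.keys m \<subseteq> VX ` {1..n} \<union> VY ` {1..n}},
          monoid.mult = (*), one = 1, zero = 0, add = (+)\<rparr>"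

subsection \<open>Reverse lexicographic order\<close>

definition mdeg :: "monom \<Rightarrow> nat" where
  "mdeg u = (\<Sum>x \<in> Poly_Mapping.keys u. Poly_Mapping.lookup u x)"

text \<open>\<open>Y\<^sub>1 > Y\<^sub>2 > \<dots> > X\<^sub>1 > X\<^sub>2 > \<dots>\<close>\<close>

fun var_less :: "var \<Rightarrow> var \<Rightarrow> bool" where
  "var_less (VX i) (VX j) \<longleftrightarrow> j < i"
| "var_less (VX i) (VY j) \<longleftrightarrow> True"
| "var_less (VY i) (VX j) \<longleftrightarrow> False"
| "var_less (VY i) (VY j) \<longleftrightarrow> j < i"

definition revlex_less :: "monom \<Rightarrow> monom \<Rightarrow> bool" where
  "revlex_less v u \<longleftrightarrow> mdeg v < mdeg u \<or>
     mdeg v = mdeg u \<and>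
     (\<exists>x. Poly_Mapping.lookup u x < Poly_Mapping.lookup v x \<and>
          (\<forall>y. var_less y x \<longrightarrow> Poly_Mapping.lookup u y = Poly_Mapping.lookup v y))"

subsection \<open>Groebner bases\<close>

text \<open>Monomial orders are given by their strict part \<open>lt\<close>. The leading monomial is only
  meaningful for nonzero polynomials.\<close>

definition lead_monom :: "(monom \<Rightarrow> monom \<Rightarrow> bool) \<Rightarrow> 'k::field xypoly \<Rightarrow> monom" where
  "lead_monom lt f =
     (THE m. m \<in> Poly_Mapping.keys f \<and> (\<forall>m' \<in> Poly_Mapping.keys f. m' = m \<or> lt m' m))"

definition initial_ideal ::
    "nat \<Rightarrow> (monom \<Rightarrow> monom \<Rightarrow> bool) \<Rightarrow> 'k::field xypoly set \<Rightarrow> 'k xypoly set" where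
  "initial_ideal n lt F =
     Idl\<^bsub>S n\<^esub> {Poly_Mapping.single (lead_monom lt f) 1 | f. f \<in> F \<and> f \<noteq> 0}"

definition groebner_basis ::
    "nat \<Rightarrow> (monom \<Rightarrow> monom \<Rightarrow> bool) \<Rightarrow> 'k::field xypoly set \<Rightarrow> 'k xypoly set \<Rightarrow> bool" where
  "groebner_basis n lt I B \<longleftrightarrow>
     finite B \<and> B \<subseteq> I \<and> 0 \<notin> B \<and> initial_ideal n lt B = initial_ideal n lt I"

definition monom_dvd :: "monom \<Rightarrow> monom \<Rightarrow> bool" where
  "monom_dvd u v \<longleftrightarrow> (\<exists>w. v = u + w)"

definition reduced_groebner_basis ::
    "nat \<Rightarrow> (monom \<Rightarrow> monom \<Rightarrow> bool) \<Rightarrow> 'k::field xypoly set \<Rightarrow> 'k xypoly set \<Rightarrow> bool" where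
  "reduced_groebner_basis n lt I B \<longleftrightarrow>
     groebner_basis n lt I B \<and>
     (\<forall>g \<in> B. Poly_Mapping.lookup g (lead_monom lt g) = 1) \<and>
     (\<forall>g \<in> B. \<forall>h \<in> B. h \<noteq> g \<longrightarrow>
        (\<forall>m \<in> Poly_Mapping.keys g. \<not> monom_dvd (lead_monom lt h) m))"

subsection \<open>Graphs, walks and irreducible paths\<close>

definition simple_graph :: "nat \<Rightarrow> nat set set \<Rightarrow> bool" where
  "simple_graph n E \<longleftrightarrow> (\<forall>e \<in> E. e \<subseteq> {1..n} \<and> card e = 2)"

text \<open>A walk \<open>p\<^sub>0 p\<^sub>1 \<dots> p\<^sub>l\<close> is the list of its \<open>l + 1\<close> vertices.\<close>

definition walk :: "nat \<Rightarrow> nat set set \<Rightarrow> nat list \<Rightarrow> bool" where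
  "walk n E P \<longleftrightarrow> P \<noteq> [] \<and> set P \<subseteq> {1..n} \<and>
     (\<forall>i. i + 1 < length P \<longrightarrow> {P ! i, P ! (i + 1)} \<in> E) \<and> hd P \<le> last P"

definition is_path :: "nat \<Rightarrow> nat set set \<Rightarrow> nat list \<Rightarrow> bool" where
  "is_path n E P \<longleftrightarrow> walk n E P \<and> distinct P"

definition joints :: "nat list \<Rightarrow> nat set" where
  "joints P = {P ! i | i. 0 < i \<and> i < length P - 1}"

definition walk_le :: "nat list \<Rightarrow> nat list \<Rightarrow> bool" where
  "walk_le P Q \<longleftrightarrow> (\<exists>j :: nat \<Rightarrow> nat.
     j 0 = 0 \<and> j (length P - 1) = length Q - 1 \<and>
     (\<forall>i. i + 1 < length P \<longrightarrow> j i < j (i + 1)) \<and>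
     (\<forall>i < length P. Q ! j i = P ! i))"

definition minimal_walk :: "nat \<Rightarrow> nat set set \<Rightarrow> nat list \<Rightarrow> bool" where
  "minimal_walk n E P \<longleftrightarrow> walk n E P \<and> (\<forall>Q. walk n E Q \<and> walk_le Q P \<longrightarrow> Q = P)"

text \<open>Closed walks such as \<open>p q p\<close> can also be minimal for \<^const>\<open>walk_le\<close>, hence the explicit
  requirement that \<open>P\<close> be a path. Its length is at least 1, i.e. it has at least two vertices.\<close>

definition irreducible_path :: "nat \<Rightarrow> nat set set \<Rightarrow> nat list \<Rightarrow> bool" where
  "irreducible_path n E P \<longleftrightarrow>
     is_path n E P \<and> length P \<ge> 2 \<and> minimal_walk n E P \<and>
     \<not> (\<exists>p \<in> joints P. hd P < p \<and> p < last P)"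

subsection \<open>Binomial edge ideals\<close>

definition binom :: "nat \<Rightarrow> nat \<Rightarrow> 'k::field xypoly" where
  "binom i j = X i * Y j - Y i * X j"

definition edge_ideal :: "nat \<Rightarrow> nat set set \<Rightarrow> 'k::field xypoly set" where
  "edge_ideal n E = Idl\<^bsub>S n\<^esub> {binom i j | i j. {i, j} \<in> E}"

text \<open>A joint of an irreducible path is either smaller than the first or larger than the last
  vertex, so the \<open>else\<close> branch below is the case \<open>p > last P\<close>.\<close>

definition path_poly :: "nat list \<Rightarrow> 'k::field xypoly" where
  "path_poly P = (\<Prod>p \<in> joints P. if p < hd P then Y p else X p) * binom (hd P) (last P)"

end

theory Submission imports Defs begin

text \<open>
  The ideal \<open>I\<^sub>G\<close> is spanned by the differences \<open>w X\<^sub>i Y\<^sub>j - w Y\<^sub>i X\<^sub>j\<close> for edges \<open>{i, j}\<close>, so Buchberger's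
  criterion can be avoided. Read a monomial as a configuration of tokens, each sitting at a vertex and
  marked \<open>X\<close> or \<open>Y\<close>; the generators exchange the marks of two tokens on adjacent vertices. Hence the
  multidegree, and the number of \<open>X\<close>-tokens in each component of the subgraph induced on the occupied
  vertices, are constant modulo \<open>I\<^sub>G\<close>: the coefficients of an element of \<open>I\<^sub>G\<close> add up to zero over each class
  of monomials with the same invariants.

  The leading monomial \<open>m\<close> of a nonzero \<open>f \<in> I\<^sub>G\<close> therefore has a smaller companion in its class. At
  the smallest variable where they differ, which is some \<open>X\<^sub>k\<close>, the companion has the larger exponent;
  so \<open>Y\<^sub>k\<close> divides \<open>m\<close>, and counting \<open>X\<close>-tokens in the component of \<open>k\<close> yields \<open>i < k\<close> in that component
  with \<open>X\<^sub>i\<close> dividing \<open>m\<close>. A shortest path \<open>P\<close> from such an \<open>X\<close> to such a \<open>Y\<close> is irreducible, and the leading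
  monomial of \<open>g\<^sub>P\<close> divides \<open>m\<close>.

  For reducedness, divisibility between terms of \<open>g\<^sub>P\<close> and the leading term of \<open>g\<^sub>Q\<close> forces \<open>Q\<close> to run inside
  \<open>P\<close> between the same ends, and an induced path contains no smaller such walk.
\<close>

subsection \<open>Polynomials and the monomial order\<close>

abbreviation vars_upto :: "nat \<Rightarrow> var set" where
  "vars_upto n \<equiv> VX ` {1..n} \<union> VY ` {1..n}"

section \<open>The ring \<open>S n\<close> and its ideals\<close>

lemma carrier_S: "f \<in> carrier (S n) \<longleftrightarrow> (\<forall>m \<in> Poly_Mapping.keys f. Poly_Mapping.keys m \<subseteq> vars_upto n)"
  and mult_S [simp]: "monoid.mult (S n) = (*)"
  and one_S [simp]: "monoid.one (S n) = 1"
  and zero_S [simp]: "ring.zero (S n) = 0"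
  and add_S [simp]: "ring.add (S n) = (+)"
  by (simp_all add: S_def)

lemma carrier_S_closed:
  fixes f g :: "'k::field xypoly"
  shows "0 \<in> carrier (S n :: 'k xypoly ring)"
    and "1 \<in> carrier (S n :: 'k xypoly ring)"
    and "f \<in> carrier (S n) \<Longrightarrow> - f \<in> carrier (S n)"
    and "f \<in> carrier (S n) \<Longrightarrow> g \<in> carrier (S n) \<Longrightarrow> f + g \<in> carrier (S n)"
    and "f \<in> carrier (S n) \<Longrightarrow> g \<in> carrier (S n) \<Longrightarrow> f * g \<in> carrier (S n)"
proof -
  show "f + g \<in> carrier (S n)" if "f \<in> carrier (S n)" "g \<in> carrier (S n)"
    using that keys_add[of f g] unfolding carrier_S by blast
  show "f * g \<in> carrier (S n)" if "f \<in> carrier (S n)" "g \<in> carrier (S n)"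
    unfolding carrier_S
  proof
    fix m assume "m \<in> Poly_Mapping.keys (f * g)"
    then obtain a b where "m = a + b" "a \<in> Poly_Mapping.keys f" "b \<in> Poly_Mapping.keys g"
      using keys_mult[of f g] by blast
    then show "Poly_Mapping.keys m \<subseteq> vars_upto n"
      using that keys_add[of a b] unfolding carrier_S by blast
  qed
qed (auto simp: carrier_S in_keys_iff)

lemma single_in_carrier_S:
  "Poly_Mapping.keys m \<subseteq> vars_upto n \<Longrightarrow> Poly_Mapping.single m c \<in> carrier (S n)"
  by (cases "c = 0") (auto simp: carrier_S)

lemma cring_S: "cring (S n :: 'k::field xypoly ring)"
proof (intro cringI abelian_groupI comm_monoidI)
  show "\<exists>y \<in> carrier (S n). y \<oplus>\<^bsub>S n\<^esub> x = \<zero>\<^bsub>S n\<^esub>" if "x \<in> carrier (S n)" for x :: "'k xypoly"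
    using that carrier_S_closed(3) by (intro bexI[of _ "- x"]) auto
qed (auto simp: carrier_S_closed algebra_simps)

lemma ring_S: "ring (S n :: 'k::field xypoly ring)"
  using cring_S cring.axioms(1) by blast

text \<open>Closure under negation follows from closure under multiplication, since
  \<open>- 1\<close> lies in \<open>S n\<close>.\<close>

lemma ideal_S_I:
  fixes I :: "'k::field xypoly set"
  assumes "I \<subseteq> carrier (S n)" "0 \<in> I"
    and "\<And>f g. f \<in> I \<Longrightarrow> g \<in> I \<Longrightarrow> f + g \<in> I"
    and mult: "\<And>f g. f \<in> carrier (S n) \<Longrightarrow> g \<in> I \<Longrightarrow> f * g \<in> I"
  shows "ideal I (S n)"
proof (rule idealI[OF ring_S])
  interpret R: ring "S n :: 'k xypoly ring" by (rule ring_S)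
  show "subgroup I (add_monoid (S n))"
  proof (rule group.subgroupI[OF R.add.group_axioms])
    fix f assume f: "f \<in> I"
    then have "f \<in> carrier (S n)" using assms(1) by blast
    then have "\<ominus>\<^bsub>S n\<^esub> f = - f"
      by (intro R.minus_equality) (auto simp: carrier_S_closed)
    moreover have "- f \<in> I"
      using mult[OF carrier_S_closed(3)[OF carrier_S_closed(2)] f] by simp
    ultimately show "inv\<^bsub>add_monoid (S n)\<^esub> f \<in> I"
      by (simp add: a_inv_def)
  qed (use assms in auto)
  show "f \<otimes>\<^bsub>S n\<^esub> g \<in> I" if "g \<in> I" "f \<in> carrier (S n)" for f g
    using mult that by simp
  show "g \<otimes>\<^bsub>S n\<^esub> f \<in> I" if "g \<in> I" "f \<in> carrier (S n)" for f g
    using mult[of f g] that by (simp add: mult.commute)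
qed

lemma ideal_S_closed:
  fixes I :: "'k::field xypoly set"
  assumes "ideal I (S n)"
  shows "I \<subseteq> carrier (S n)"
    and "f \<in> I \<Longrightarrow> g \<in> I \<Longrightarrow> f + g \<in> I"
    and "c \<in> carrier (S n) \<Longrightarrow> f \<in> I \<Longrightarrow> c * f \<in> I"
  using ideal.I_l_closed[OF assms] additive_subgroup.a_subset[OF ideal.axioms(1)[OF assms]]
    additive_subgroup.a_closed[OF ideal.axioms(1)[OF assms]] by auto

lemma poly_mapping_eq_sum_single:
  fixes f :: "'a \<Rightarrow>\<^sub>0 'b::comm_monoid_add"
  shows "f = (\<Sum>m \<in> Poly_Mapping.keys f. Poly_Mapping.single m (Poly_Mapping.lookup f m))"
  by (rule poly_mapping_eqI)
    (auto simp: lookup_sum lookup_single when_def in_keys_iff)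

lemma prod_single_one:
  "(\<Prod>p \<in> A. Poly_Mapping.single (g p) 1) =
    (Poly_Mapping.single (\<Sum>p \<in> A. g p) 1 :: ('a::comm_monoid_add) \<Rightarrow>\<^sub>0 'b::comm_semiring_1)"
  by (induction A rule: infinite_finite_induct) (auto simp: mult_single)

section \<open>Sums of coefficients over a class of monomials\<close>

definition coeff_sum :: "('a \<Rightarrow> bool) \<Rightarrow> ('a \<Rightarrow>\<^sub>0 'b::comm_monoid_add) \<Rightarrow> 'b" where
  "coeff_sum P f = (\<Sum>m \<in> Poly_Mapping.keys f. if P m then Poly_Mapping.lookup f m else 0)"

lemma coeff_sum_superset:
  "finite A \<Longrightarrow> Poly_Mapping.keys f \<subseteq> A \<Longrightarrow>
    coeff_sum P f = (\<Sum>m \<in> A. if P m then Poly_Mapping.lookup f m else 0)"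
  unfolding coeff_sum_def by (rule sum.mono_neutral_left) (auto simp: in_keys_iff)

lemma coeff_sum_zero [simp]: "coeff_sum P 0 = 0"
  by (simp add: coeff_sum_def)

lemma coeff_sum_add:
  fixes f g :: "'a \<Rightarrow>\<^sub>0 'b::comm_monoid_add"
  shows "coeff_sum P (f + g) = coeff_sum P f + coeff_sum P g"
proof -
  \<comment> \<open>Cancellation can shrink the keys of \<open>f + g\<close>, so all three sums are
    taken over one common finite set.\<close>
  let ?A = "Poly_Mapping.keys f \<union> Poly_Mapping.keys g"
  have *: "coeff_sum P h = (\<Sum>m \<in> ?A. if P m then Poly_Mapping.lookup h m else 0)"
    if "Poly_Mapping.keys h \<subseteq> ?A" for h :: "'a \<Rightarrow>\<^sub>0 'b"
    using that by (intro coeff_sum_superset) auto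
  then show ?thesis
    by (subst (1 2 3) *) (use keys_add[of f g] in
      \<open>auto simp: sum.distrib[symmetric] lookup_add intro!: sum.cong\<close>)
qed

lemma coeff_sum_sum: "coeff_sum P (\<Sum>a \<in> A. f a) = (\<Sum>a \<in> A. coeff_sum P (f a))"
  by (induction A rule: infinite_finite_induct) (auto simp: coeff_sum_add)

lemma coeff_sum_single: "coeff_sum P (Poly_Mapping.single m c) = (if P m then c else 0)"
  by (subst coeff_sum_superset[of "{m}"]) (auto split: if_splits)

text \<open>A term of \<open>f\<close> at \<open>w\<close> contributes opposite coefficients at
  \<open>w + u\<close> and \<open>w + v\<close>, which \<open>P\<close> does not tell apart.\<close>

lemma coeff_sum_mult_eq_0:
  fixes f :: "'a::comm_monoid_add \<Rightarrow>\<^sub>0 'b::comm_ring_1"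
  assumes "\<And>w. P (w + u) \<longleftrightarrow> P (w + v)"
  shows "coeff_sum P (f * (Poly_Mapping.single u 1 - Poly_Mapping.single v 1)) = 0"
proof -
  let ?d = "Poly_Mapping.single u 1 - Poly_Mapping.single v 1 :: 'a \<Rightarrow>\<^sub>0 'b"
  have "coeff_sum P (Poly_Mapping.single w c * ?d) = 0" for w c
  proof -
    have "Poly_Mapping.single w c * ?d =
        Poly_Mapping.single (w + u) c + Poly_Mapping.single (w + v) (- c)"
      by (simp add: right_diff_distrib mult_single single_uminus)
    then show ?thesis
      using assms by (simp add: coeff_sum_add coeff_sum_single)
  qed
  then show ?thesis
    by (subst poly_mapping_eq_sum_single[of f])
      (simp add: sum_distrib_right coeff_sum_sum)
qed

section \<open>Degree, monomial order and leading monomials\<close>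

lemma mdeg_superset:
  "finite A \<Longrightarrow> Poly_Mapping.keys u \<subseteq> A \<Longrightarrow> mdeg u = (\<Sum>x \<in> A. Poly_Mapping.lookup u x)"
  unfolding mdeg_def by (rule sum.mono_neutral_left) (auto simp: in_keys_iff)

lemma mdeg_add: "mdeg (u + v) = mdeg u + mdeg v"
proof -
  let ?A = "Poly_Mapping.keys u \<union> Poly_Mapping.keys v"
  have "mdeg w = (\<Sum>x \<in> ?A. Poly_Mapping.lookup w x)" if "Poly_Mapping.keys w \<subseteq> ?A" for w
    using that by (intro mdeg_superset) auto
  then show ?thesis
    using keys_add[of u v] by (auto simp: sum.distrib[symmetric] lookup_add)
qed

lemma mdeg_single [simp]: "mdeg (Poly_Mapping.single x k) = k"
  by (simp add: mdeg_superset[of "{x}"])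

lemma var_less_irrefl: "\<not> var_less x x"
  by (cases x) auto

lemma var_less_trans: "var_less x y \<Longrightarrow> var_less y z \<Longrightarrow> var_less x z"
  by (cases x; cases y; cases z) auto

lemma var_less_linear: "x \<noteq> y \<Longrightarrow> var_less x y \<or> var_less y x"
  by (cases x; cases y) auto

lemma revlex_less_irrefl: "\<not> revlex_less u u"
  by (simp add: revlex_less_def)

text \<open>In equal degrees, the smaller of the two distinguishing variables also distinguishes
  \<open>u\<close> from \<open>w\<close>.\<close>

lemma revlex_less_trans:
  assumes "revlex_less u v" "revlex_less v w"
  shows "revlex_less u w"
proof (cases "mdeg u = mdeg v \<and> mdeg v = mdeg w")
  case True
  then obtain x y where
    x: "Poly_Mapping.lookup v x < Poly_Mapping.lookup u x"
      "\<And>z. var_less z x \<Longrightarrow> Poly_Mapping.lookup v z = Poly_Mapping.lookup u z" and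
    y: "Poly_Mapping.lookup w y < Poly_Mapping.lookup v y"
      "\<And>z. var_less z y \<Longrightarrow> Poly_Mapping.lookup w z = Poly_Mapping.lookup v z"
    using assms unfolding revlex_less_def by auto
  show ?thesis
  proof (cases "var_less y x")
    case True
    then show ?thesis
      using \<open>mdeg u = mdeg v \<and> mdeg v = mdeg w\<close> x y var_less_trans
      unfolding revlex_less_def by (metis (no_types, lifting))
  next
    case False
    then have "x = y \<or> var_less x y" using var_less_linear by blast
    then show ?thesis
      using \<open>mdeg u = mdeg v \<and> mdeg v = mdeg w\<close> x y var_less_trans
      unfolding revlex_less_def by (metis (no_types, lifting) less_trans)
  qed
qed (use assms in \<open>auto simp: revlex_less_def\<close>)

text \<open>The variables descend forever, but only finitely many tell \<open>u\<close> and
  \<open>v\<close> apart, so a smallest such variable exists.\<close>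

lemma revlex_less_linear:
  assumes "u \<noteq> v"
  shows "revlex_less u v \<or> revlex_less v u"
proof -
  let ?D = "{x. Poly_Mapping.lookup u x \<noteq> Poly_Mapping.lookup v x}"
  have "?D \<subseteq> Poly_Mapping.keys u \<union> Poly_Mapping.keys v"
    by (auto simp: in_keys_iff)
  then have "finite ?D"
    by (rule finite_subset) simp
  moreover have "?D \<noteq> {}"
    using poly_mapping_eqI[of u v] assms by blast
  moreover have "transp_on ?D var_less" "totalp_on ?D var_less"
    unfolding transp_on_def totalp_on_def using var_less_trans var_less_linear by blast+
  ultimately obtain x where x: "x \<in> ?D" "\<And>y. y \<in> ?D \<Longrightarrow> y \<noteq> x \<Longrightarrow> var_less x y"
    using Finite_Set.bex_least_element[of ?D var_less] by blast
  have "Poly_Mapping.lookup u y = Poly_Mapping.lookup v y" if "var_less y x" for y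
    using that x(2)[of y] var_less_trans var_less_irrefl by blast
  then show ?thesis
    using x(1) unfolding revlex_less_def
    by (cases "Poly_Mapping.lookup u x" "Poly_Mapping.lookup v x" rule: linorder_cases;
        cases "mdeg u" "mdeg v" rule: linorder_cases) auto
qed

lemma lead_monom_eqI:
  assumes "m \<in> Poly_Mapping.keys f" "\<And>m'. m' \<in> Poly_Mapping.keys f \<Longrightarrow> m' = m \<or> revlex_less m' m"
  shows "lead_monom revlex_less f = m"
  unfolding lead_monom_def
proof (rule the_equality)
  fix m'
  assume "m' \<in> Poly_Mapping.keys f \<and> (\<forall>m'' \<in> Poly_Mapping.keys f. m'' = m' \<or> revlex_less m'' m')"
  then show "m' = m"
    using assms(1) assms(2)[of m'] revlex_less_trans[of m m' m] revlex_less_irrefl[of m] by metis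
qed (use assms in blast)

lemma lead_monom_revlex:
  assumes "f \<noteq> 0"
  shows "lead_monom revlex_less f \<in> Poly_Mapping.keys f"
    and "m' \<in> Poly_Mapping.keys f \<Longrightarrow>
      m' = lead_monom revlex_less f \<or> revlex_less m' (lead_monom revlex_less f)"
proof -
  have "transp_on (Poly_Mapping.keys f) revlex_less" "totalp_on (Poly_Mapping.keys f) revlex_less"
    unfolding transp_on_def totalp_on_def using revlex_less_trans revlex_less_linear by blast+
  then obtain m where m: "m \<in> Poly_Mapping.keys f"
      "\<And>m'. m' \<in> Poly_Mapping.keys f \<Longrightarrow> m' = m \<or> revlex_less m' m"
    using Finite_Set.bex_greatest_element[of "Poly_Mapping.keys f" revlex_less] assms
    by auto
  then have "lead_monom revlex_less f = m" by (rule lead_monom_eqI)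
  then show "lead_monom revlex_less f \<in> Poly_Mapping.keys f"
    and "m' \<in> Poly_Mapping.keys f \<Longrightarrow>
      m' = lead_monom revlex_less f \<or> revlex_less m' (lead_monom revlex_less f)"
    using m by auto
qed

lemma monom_dvd_iff: "monom_dvd u v \<longleftrightarrow> (\<forall>x. Poly_Mapping.lookup u x \<le> Poly_Mapping.lookup v x)"
proof
  assume "\<forall>x. Poly_Mapping.lookup u x \<le> Poly_Mapping.lookup v x"
  \<comment> \<open>Subtraction of exponents is truncated; the assumption makes it exact.\<close>
  then have "v = u + (v - u)"
    by (intro poly_mapping_eqI) (simp add: lookup_add lookup_minus)
  then show "monom_dvd u v" unfolding monom_dvd_def by blast
qed (auto simp: monom_dvd_def lookup_add)

lemma lookup_sum_single_inj:
  assumes "finite A" "inj_on g A"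
  shows "Poly_Mapping.lookup (\<Sum>p \<in> A. Poly_Mapping.single (g p) (1::nat)) x = (if x \<in> g ` A then 1 else 0)"
proof -
  have "(\<Sum>p \<in> A. Poly_Mapping.single (g p) (1::nat)) = (\<Sum>y \<in> g ` A. Poly_Mapping.single y 1)"
    by (simp add: sum.reindex[OF assms(2)])
  then show ?thesis
    using assms(1) by (simp add: lookup_sum lookup_single when_def)
qed

subsection \<open>Paths and their polynomials\<close>

lemma walk_iff:
  "walk n E P \<longleftrightarrow> P \<noteq> [] \<and> set P \<subseteq> {1..n} \<and> successively (\<lambda>a b. {a, b} \<in> E) P \<and> hd P \<le> last P"
  by (auto simp: walk_def successively_conv_nth)

lemma list_length_ge_2_cases:
  assumes "length P \<ge> 2"
  obtains a xs b where "P = a # xs @ [b]"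
proof -
  from assms obtain a ys where "P = a # ys" "ys \<noteq> []"
    by (cases P) fastforce+
  then show ?thesis
    using that[of a "butlast ys" "last ys"] by simp
qed

lemma joints_Cons_append [simp]: "joints (a # xs @ [b]) = set xs"
proof -
  have "{i. 0 < i \<and> i < Suc (length xs)} = Suc ` {..<length xs}"
    by (auto simp: image_iff gr0_conv_Suc)
  then have "joints (a # xs @ [b]) = (\<lambda>i. (a # xs @ [b]) ! Suc i) ` {..<length xs}"
    unfolding joints_def by (simp add: setcompr_eq_image image_image)
  also have "\<dots> = set xs"
    by (auto simp: set_conv_nth nth_append)
  finally show ?thesis .
qed

text \<open>For a joint \<open>p\<close> of an irreducible path this is the variable
  \<open>Z_p\<close>.\<close>

definition joint_var :: "nat list \<Rightarrow> nat \<Rightarrow> var" where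
  "joint_var P p = (if p < hd P then VY p else VX p)"

definition joint_monom :: "nat list \<Rightarrow> monom" where
  "joint_monom P = (\<Sum>p \<in> joints P. Poly_Mapping.single (joint_var P p) 1)"

definition xy_monom :: "nat \<Rightarrow> nat \<Rightarrow> monom" where
  "xy_monom i j = Poly_Mapping.single (VX i) 1 + Poly_Mapping.single (VY j) 1"

definition path_lead :: "nat list \<Rightarrow> monom" where
  "path_lead P = joint_monom P + xy_monom (hd P) (last P)"

definition path_trail :: "nat list \<Rightarrow> monom" where
  "path_trail P = joint_monom P + xy_monom (last P) (hd P)"

lemma lookup_xy_monom [simp]:
  "Poly_Mapping.lookup (xy_monom i j) (VX k) = (if k = i then 1 else 0)"
  "Poly_Mapping.lookup (xy_monom i j) (VY k) = (if k = j then 1 else 0)"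
  by (auto simp: xy_monom_def lookup_add lookup_single when_def)

lemma mdeg_xy_monom [simp]: "mdeg (xy_monom i j) = 2"
  by (simp add: xy_monom_def mdeg_add)

lemma binom_eq:
  "binom i j = Poly_Mapping.single (xy_monom i j) 1 - Poly_Mapping.single (xy_monom j i) 1"
  by (simp add: binom_def X_def Y_def xy_monom_def mult_single add.commute)

lemma path_poly_eq:
  "(path_poly P :: 'k::field xypoly) = Poly_Mapping.single (path_lead P) 1 - Poly_Mapping.single (path_trail P) 1"
proof -
  have "(\<Prod>p \<in> joints P. if p < hd P then Y p else X p) =
      (Poly_Mapping.single (joint_monom P) 1 :: 'k::field xypoly)"
    unfolding joint_monom_def prod_single_one[symmetric]
    by (intro prod.cong) (auto simp: X_def Y_def joint_var_def)
  then show ?thesis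
    by (simp add: path_poly_def binom_eq right_diff_distrib mult_single
        path_lead_def path_trail_def)
qed

text \<open>The two terms share the joint monomial. The smallest variable where they differ is
  \<open>VX (last P)\<close>, which divides the trailing term to the higher power.\<close>

lemma path_trail_less:
  assumes "hd P < last P"
  shows "revlex_less (path_trail P) (path_lead P)"
proof -
  have "Poly_Mapping.lookup (path_lead P) x = Poly_Mapping.lookup (path_trail P) x"
    if "var_less x (VX (last P))" for x
    using that assms by (cases x) (auto simp: path_lead_def path_trail_def lookup_add)
  then show ?thesis
    using assms unfolding revlex_less_def
    by (intro disjI2 conjI exI[of _ "VX (last P)"])
      (auto simp: path_lead_def path_trail_def mdeg_add lookup_add)
qed

lemma path_poly_lead:
  assumes "hd P < last P"
  shows "Poly_Mapping.keys (path_poly P :: 'k::field xypoly) = {path_lead P, path_trail P}"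
    and "lead_monom revlex_less (path_poly P :: 'k::field xypoly) = path_lead P"
    and "Poly_Mapping.lookup (path_poly P :: 'k::field xypoly) (path_lead P) = 1"
proof -
  have ne: "path_trail P \<noteq> path_lead P"
    using path_trail_less[OF assms] revlex_less_irrefl by metis
  show keys: "Poly_Mapping.keys (path_poly P :: 'k::field xypoly) = {path_lead P, path_trail P}"
    using ne by (auto simp: path_poly_eq in_keys_iff lookup_minus lookup_single when_def split: if_splits)
  show "lead_monom revlex_less (path_poly P :: 'k::field xypoly) = path_lead P"
    using path_trail_less[OF assms] by (intro lead_monom_eqI) (auto simp: keys)
  show "Poly_Mapping.lookup (path_poly P :: 'k::field xypoly) (path_lead P) = 1"
    using ne by (simp add: path_poly_eq lookup_minus lookup_single when_def)
qed

lemma irreducible_pathD: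
  assumes "irreducible_path n E P"
  shows "distinct P" "walk n E P" "minimal_walk n E P" "length P \<ge> 2" "hd P < last P"
    "set P \<subseteq> {1..n}" "joints P = set P - {hd P, last P}"
    "p \<in> joints P \<Longrightarrow> p < hd P \<or> p > last P"
proof -
  show P: "distinct P" "walk n E P" "minimal_walk n E P" "length P \<ge> 2"
    using assms by (auto simp: irreducible_path_def is_path_def)
  show "set P \<subseteq> {1..n}" using P by (auto simp: walk_def)
  obtain a xs b where [simp]: "P = a # xs @ [b]"
    using P list_length_ge_2_cases by blast
  show "hd P < last P" "joints P = set P - {hd P, last P}"
    using P by (auto simp: walk_iff)
  then show "p \<in> joints P \<Longrightarrow> p < hd P \<or> p > last P"
    using assms unfolding irreducible_path_def by (metis DiffE insertCI linorder_neqE_nat)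
qed

text \<open>Joints are distinct from each other and from the ends, so the leading monomial is
  squarefree and divisibility by it becomes a question of membership.\<close>

lemma lookup_path_lead:
  assumes "irreducible_path n E P"
  shows "Poly_Mapping.lookup (path_lead P) x =
    (if x \<in> joint_var P ` joints P \<union> {VX (hd P), VY (last P)} then 1 else 0)"
proof -
  note P = irreducible_pathD[OF assms]
  have fin: "finite (joints P)" and inj: "inj_on (joint_var P) (joints P)"
    using P(7) by (auto simp: inj_on_def joint_var_def)
  have "VX (hd P) \<notin> joint_var P ` joints P" "VY (last P) \<notin> joint_var P ` joints P"
    using P(7) by (auto simp: joint_var_def)
  then show ?thesis
    unfolding path_lead_def joint_monom_def lookup_add lookup_sum_single_inj[OF fin inj]
    by (cases x) auto
qed

text \<open>Both cases rest on a three-term relation: \<open>X\<^sub>b [a,l] = X\<^sub>a [b,l] + X\<^sub>l [a,b]\<close>,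
  and likewise with \<open>Y\<close> in place of the outer \<open>X\<close>.\<close>

lemma prod_list_walk_binom_mem:
  fixes I :: "'k::field xypoly set"
  assumes I: "ideal I (S n)" and E: "\<And>i j. {i, j} \<in> E \<Longrightarrow> binom i j \<in> I"
    and Z: "\<And>p. Z p = X p \<or> Z p = Y p"
  shows "successively (\<lambda>a b. {a, b} \<in> E) (a # xs @ [b]) \<Longrightarrow> set (a # xs @ [b]) \<subseteq> {1..n} \<Longrightarrow>
    prod_list (map Z xs) * binom a b \<in> I"
proof (induction xs arbitrary: a)
  case Nil
  then show ?case using E by simp
next
  case (Cons c xs)
  note closed = ideal_S_closed[OF I]
  have XY: "X p \<in> carrier (S n)" "Y p \<in> carrier (S n)" if "p \<in> {1..n}" for p
    using that unfolding X_def Y_def by (auto intro!: single_in_carrier_S)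
  then have "Z p \<in> carrier (S n)" if "p \<in> {1..n}" for p
    using that Z by metis
  then have "set ys \<subseteq> {1..n} \<Longrightarrow> prod_list (map Z ys) \<in> carrier (S n)" for ys
    by (induction ys) (auto intro: carrier_S_closed)
  then have R: "prod_list (map Z xs) \<in> carrier (S n)"
    using Cons.prems by simp
  have 1: "prod_list (map Z xs) * binom c b \<in> I"
    using Cons.prems by (intro Cons.IH) auto
  have 2: "prod_list (map Z xs) * binom a c \<in> I"
    using Cons.prems E R closed(3) by auto
  \<comment> \<open>The relation at \<open>c\<close> needs the letter chosen there also at
    \<open>a\<close> and \<open>b\<close>.\<close>
  obtain V where V: "V = X \<or> V = Y" "Z c = V c"
    using Z by blast
  then have "V a \<in> carrier (S n)" "V b \<in> carrier (S n)"
    using XY Cons.prems by auto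
  then have "V a * (prod_list (map Z xs) * binom c b) + V b * (prod_list (map Z xs) * binom a c) \<in> I"
    using 1 2 closed by blast
  also have "V a * (prod_list (map Z xs) * binom c b) + V b * (prod_list (map Z xs) * binom a c) =
      prod_list (map Z (c # xs)) * binom a b"
    using V by (auto simp: binom_def algebra_simps)
  finally show ?case .
qed

section \<open>The edge ideal and its path polynomials\<close>

lemma edge_ideal_generated:
  fixes n :: nat
  assumes "simple_graph n E"
  shows "ideal (edge_ideal n E :: 'k::field xypoly set) (S n)"
    and "{i, j} \<in> E \<Longrightarrow> binom i j \<in> (edge_ideal n E :: 'k::field xypoly set)"
    and "ideal J (S n) \<Longrightarrow> (\<And>i j. {i, j} \<in> E \<Longrightarrow> binom i j \<in> J) \<Longrightarrow> (edge_ideal n E :: 'k::field xypoly set) \<subseteq> J"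
proof -
  interpret R: ring "S n :: 'k xypoly ring" by (rule ring_S)
  have "X p \<in> carrier (S n :: 'k xypoly ring)" "Y p \<in> carrier (S n :: 'k xypoly ring)" if "p \<in> {1..n}" for p
    using that unfolding X_def Y_def by (auto intro!: single_in_carrier_S)
  moreover have "i \<in> {1..n} \<and> j \<in> {1..n}" if "{i, j} \<in> E" for i j
    using assms that unfolding simple_graph_def by blast
  ultimately have "binom i j \<in> carrier (S n :: 'k xypoly ring)" if "{i, j} \<in> E" for i j
    using that unfolding binom_def diff_conv_add_uminus by (intro carrier_S_closed) blast+
  then have gen: "{binom i j | i j. {i, j} \<in> E} \<subseteq> carrier (S n :: 'k xypoly ring)"
    by blast
  show "ideal (edge_ideal n E :: 'k xypoly set) (S n)"
    unfolding edge_ideal_def by (rule R.genideal_ideal[OF gen])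
  show "{i, j} \<in> E \<Longrightarrow> binom i j \<in> (edge_ideal n E :: 'k xypoly set)"
    unfolding edge_ideal_def using R.genideal_self[OF gen] by blast
  show "ideal J (S n) \<Longrightarrow> (\<And>i j. {i, j} \<in> E \<Longrightarrow> binom i j \<in> J) \<Longrightarrow> (edge_ideal n E :: 'k::field xypoly set) \<subseteq> J"
    unfolding edge_ideal_def by (intro R.genideal_minimal) auto
qed

lemma path_poly_mem_edge_ideal:
  assumes "simple_graph n E" "irreducible_path n E P"
  shows "path_poly P \<in> (edge_ideal n E :: 'k::field xypoly set)"
proof -
  note P = irreducible_pathD[OF assms(2)]
  obtain a xs b where eq: "P = a # xs @ [b]"
    using P(4) list_length_ge_2_cases by blast
  have "prod_list (map (\<lambda>p. if p < a then Y p else X p) xs) * binom a b \<in> (edge_ideal n E :: 'k xypoly set)"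
    using P(2) edge_ideal_generated[OF assms(1), where ?'k = 'k]
    by (intro prod_list_walk_binom_mem[where E = E]) (auto simp: walk_iff eq)
  moreover have "distinct xs" using P(1) eq by simp
  ultimately show ?thesis
    by (simp add: path_poly_def eq prod.distinct_set_conv_list)
qed

text \<open>A chord would shortcut \<open>P\<close> to a strictly shorter walk below it.\<close>

lemma minimal_walk_no_chord:
  assumes P: "minimal_walk n E P" "distinct P"
    and ab: "a + 1 < b" "b < length P" "{P ! a, P ! b} \<in> E"
  shows False
proof -
  let ?Q = "take (Suc a) P @ drop b P"
  \<comment> \<open>Embeds the shortcut into \<open>P\<close>: the first \<open>Suc a\<close>
    positions stay, and position \<open>Suc a\<close> goes to \<open>b\<close>.\<close>
  let ?j = "\<lambda>i. if i \<le> a then i else b + (i - Suc a)"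
  have walk: "walk n E P" using P(1) by (simp add: minimal_walk_def)
  have succ: "successively (\<lambda>a b. {a, b} \<in> E) P"
    using walk by (simp add: walk_iff)
  have "successively (\<lambda>a b. {a, b} \<in> E) (take (Suc a) P)" "successively (\<lambda>a b. {a, b} \<in> E) (drop b P)"
    using succ successively_append_iff[of _ "take (Suc a) P" "drop (Suc a) P"]
      successively_append_iff[of _ "take b P" "drop b P"] by auto
  moreover have "last (take (Suc a) P) = P ! a" "hd (drop b P) = P ! b"
    using ab by (simp_all add: take_Suc_conv_app_nth hd_drop_conv_nth)
  ultimately have "successively (\<lambda>a b. {a, b} \<in> E) ?Q"
    using ab by (auto simp: successively_append_iff)
  moreover have "set ?Q \<subseteq> set P" "hd ?Q = hd P" "last ?Q = last P" "?Q \<noteq> []"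
    using ab by (auto dest: in_set_takeD in_set_dropD simp: hd_append)
  ultimately have "walk n E ?Q"
    using walk unfolding walk_iff by auto
  moreover have "walk_le ?Q P"
    unfolding walk_le_def using ab
    by (intro exI[of _ ?j]) (auto simp: nth_append min_def)
  ultimately have "?Q = P"
    using P(1) by (auto simp: minimal_walk_def)
  then have "length ?Q = length P" by simp
  then show False using ab by simp
qed

text \<open>An induced path has no chords, so a walk inside it moves by at most one position at a time
  and must visit every vertex on its way from one end to the other.\<close>

lemma walk_within_minimal_path:
  assumes P: "minimal_walk n E P" "distinct P" and Q: "walk n E Q"
    and ends: "hd Q = hd P" "last Q = last P" and sub: "set Q \<subseteq> set P"
  shows "set Q = set P"
proof
  have ne: "P \<noteq> []" "Q \<noteq> []"
    using P(1) Q by (auto simp: minimal_walk_def walk_def)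
  \<comment> \<open>\<open>c s\<close> will be the position in \<open>P\<close> of vertex
    \<open>s\<close> of \<open>Q\<close>; a discrete intermediate value argument shows that it takes
    every value.\<close>
  have "\<exists>c. c < length P \<and> P ! c = Q ! s" if "s < length Q" for s
    using sub that by (metis in_set_conv_nth nth_mem subsetD)
  then obtain c where c: "\<And>s. s < length Q \<Longrightarrow> c s < length P \<and> P ! c s = Q ! s"
    by metis
  show "set P \<subseteq> set Q"
  proof
    fix p assume "p \<in> set P"
    then obtain t where t: "t < length P" "P ! t = p"
      by (auto simp: in_set_conv_nth)
    have "\<exists>s \<le> length Q - 1. int (c s) = int t"
    proof (rule nat0_intermed_int_val)
      have "P ! c 0 = P ! 0" "c 0 < length P"
        using c[of 0] ne ends(1) by (simp_all add: hd_conv_nth)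
      then have "c 0 = 0"
        using nth_eq_iff_index_eq[OF P(2), of "c 0" 0] ne by simp
      then show "int (c 0) \<le> int t" by simp
      have "P ! c (length Q - 1) = P ! (length P - 1)" "c (length Q - 1) < length P"
        using c[of "length Q - 1"] ne ends(2) by (simp_all add: last_conv_nth)
      then have "c (length Q - 1) = length P - 1"
        using nth_eq_iff_index_eq[OF P(2), of "c (length Q - 1)" "length P - 1"] ne by simp
      then show "int t \<le> int (c (length Q - 1))"
        using t by simp
      show "\<forall>i < length Q - 1. \<bar>int (c (i + 1)) - int (c i)\<bar> \<le> 1"
      proof (intro allI impI)
        fix i assume "i < length Q - 1"
        then have i: "c i < length P" "P ! c i = Q ! i" "c (i + 1) < length P" "P ! c (i + 1) = Q ! (i + 1)"
          using c[of i] c[of "i + 1"] by auto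
        have "{Q ! i, Q ! (i + 1)} \<in> E"
          using Q \<open>i < length Q - 1\<close> by (simp add: walk_def)
        then have "{P ! c i, P ! c (i + 1)} \<in> E" "{P ! c (i + 1), P ! c i} \<in> E"
          unfolding i(2,4) by (simp_all add: insert_commute)
        then have "\<not> c i + 1 < c (i + 1)" "\<not> c (i + 1) + 1 < c i"
          using minimal_walk_no_chord[OF P] i(1,3) by blast+
        then show "\<bar>int (c (i + 1)) - int (c i)\<bar> \<le> 1" by linarith
      qed
    qed
    then obtain s where "s < length Q" "c s = t"
      using ne by (cases Q) (auto simp: less_Suc_eq_le)
    then show "p \<in> set Q"
      using c[of s] t nth_mem[of s Q] by simp
  qed
qed (rule sub)

text \<open>Equality is claimed for the polynomials, not the paths: \<open>path_poly\<close> depends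
  only on the ends and the set of joints, so equal vertex sets and ends suffice.\<close>

lemma path_poly_reduced:
  assumes P: "irreducible_path n E P" and Q: "irreducible_path n E Q"
    and m: "m \<in> Poly_Mapping.keys (path_poly P :: 'k::field xypoly)" and dvd: "monom_dvd (path_lead Q) m"
  shows "path_poly Q = (path_poly P :: 'k xypoly)"
proof -
  note p = irreducible_pathD[OF P] and q = irreducible_pathD[OF Q]
  have lookup_m: "Poly_Mapping.lookup m x \<noteq> 0" if "Poly_Mapping.lookup (path_lead Q) x \<noteq> 0" for x
    using dvd that unfolding monom_dvd_iff by (metis le_zero_eq)
  have jp: "hd P \<notin> joints P" "last P \<notin> joints P" "finite (joints P)" "inj_on (joint_var P) (joints P)"
    using p(7) by (auto simp: inj_on_def joint_var_def)
  have joint_lookup: "Poly_Mapping.lookup (joint_monom P) x = (if x \<in> joint_var P ` joints P then 1 else 0)" for x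
    unfolding joint_monom_def by (rule lookup_sum_single_inj[OF jp(3,4)])
  have joint_X: "last P < v" if "Poly_Mapping.lookup (joint_monom P) (VX v) \<noteq> 0" for v
    using that p(8)[of v] unfolding joint_lookup by (auto simp: joint_var_def split: if_splits)
  have joint_Y: "v < hd P" if "Poly_Mapping.lookup (joint_monom P) (VY v) \<noteq> 0" for v
    using that unfolding joint_lookup by (auto simp: joint_var_def split: if_splits)
  have X_lead: "Poly_Mapping.lookup m (VX (hd Q)) \<noteq> 0" and Y_lead: "Poly_Mapping.lookup m (VY (last Q)) \<noteq> 0"
    by (rule lookup_m; simp add: lookup_path_lead[OF Q])+
  \<comment> \<open>In the trailing term every \<open>X\<close> sits at or above
    \<open>last P\<close> and every \<open>Y\<close> at or below \<open>hd P\<close>, leaving no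
    room for \<open>hd Q < last Q\<close>.\<close>
  have "m \<noteq> path_trail P"
  proof
    assume "m = path_trail P"
    then have "last P \<le> hd Q" "last Q \<le> hd P"
      using X_lead Y_lead joint_X[of "hd Q"] joint_Y[of "last Q"] unfolding path_trail_def
      by (auto simp: lookup_add split: if_splits)
    then show False using p(5) q(5) by simp
  qed
  then have mP: "m = path_lead P"
    using m path_poly_lead(1)[OF p(5)] by auto
  then have "hd Q = hd P \<or> last P < hd Q" "last Q = last P \<or> last Q < hd P"
    using X_lead Y_lead joint_X[of "hd Q"] joint_Y[of "last Q"] unfolding path_lead_def
    by (auto simp: lookup_add split: if_splits)
  then have ends: "hd Q = hd P" "last Q = last P"
    using p(5) q(5) by auto
  have "x \<in> joints P" if "x \<in> joints Q" for x
  proof -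
    have "joint_var P x = joint_var Q x"
      by (simp add: joint_var_def ends)
    moreover have "Poly_Mapping.lookup (path_lead P) (joint_var Q x) \<noteq> 0"
      using lookup_m[of "joint_var Q x"] that mP by (simp add: lookup_path_lead[OF Q])
    ultimately show ?thesis
      using that q(7) unfolding lookup_path_lead[OF P]
      by (auto simp: joint_var_def ends split: if_splits)
  qed
  then have "set Q - {hd P, last P} \<subseteq> set P"
    using p(7) q(7) ends by auto
  moreover have "hd P \<in> set P" "last P \<in> set P"
    using p(2) unfolding walk_def by simp_all
  ultimately have "set Q \<subseteq> set P"
    by blast
  then have "set Q = set P"
    using walk_within_minimal_path[OF p(3,1) q(2) ends] by blast
  then show ?thesis
    using p(7) q(7) ends by (simp add: path_poly_def)
qed

subsection \<open>Congruence of monomials modulo the edge ideal\<close>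

definition support :: "monom \<Rightarrow> nat set" where
  "support m = {i. Poly_Mapping.lookup m (VX i) + Poly_Mapping.lookup m (VY i) > 0}"

definition support_adj :: "nat set set \<Rightarrow> monom \<Rightarrow> (nat \<times> nat) set" where
  "support_adj E m = {(a, b). {a, b} \<in> E \<and> a \<in> support m \<and> b \<in> support m}"

text \<open>The closure is reflexive, so an unoccupied vertex of \<open>{1..n}\<close> forms a
  component by itself. Restricting to \<open>{1..n}\<close> makes finiteness immediate.\<close>

definition component :: "nat \<Rightarrow> nat set set \<Rightarrow> monom \<Rightarrow> nat \<Rightarrow> nat set" where
  "component n E m v = {u \<in> {1..n}. (v, u) \<in> (support_adj E m)\<^sup>*}"

text \<open>This is invariant under replacing \<open>w X\<^sub>i Y\<^sub>j\<close> by \<open>w Y\<^sub>i X\<^sub>j\<close> along an edge. The degree is already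
  determined by the multidegree; listing it makes it immediate that equivalent monomials have the same degree.\<close>

definition monom_class :: "nat \<Rightarrow> nat set set \<Rightarrow> monom \<Rightarrow> nat \<times> (nat \<Rightarrow> nat) \<times> (nat \<Rightarrow> nat)" where
  "monom_class n E m =
    (mdeg m, \<lambda>i. Poly_Mapping.lookup m (VX i) + Poly_Mapping.lookup m (VY i),
     \<lambda>v. \<Sum>u \<in> component n E m v. Poly_Mapping.lookup m (VX u))"

lemma sym_support_adj: "sym (support_adj E m)"
  by (auto simp: support_adj_def sym_def insert_commute)

text \<open>The exchange preserves the occupied vertices and hence the components. Both
  \<open>i\<close> and \<open>j\<close> are occupied and adjacent, so a component contains both or
  neither and keeps its number of \<open>X\<close>-tokens.\<close>

lemma monom_class_edge:
  assumes E: "simple_graph n E" "{i, j} \<in> E"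
  shows "monom_class n E (w + xy_monom i j) = monom_class n E (w + xy_monom j i)"
proof -
  let ?u = "w + xy_monom i j" and ?v = "w + xy_monom j i"
  have ij: "i \<in> {1..n}" "j \<in> {1..n}"
    using E unfolding simple_graph_def by blast+
  have deg: "Poly_Mapping.lookup ?u (VX k) + Poly_Mapping.lookup ?u (VY k) =
      Poly_Mapping.lookup ?v (VX k) + Poly_Mapping.lookup ?v (VY k)" for k
    by (simp add: lookup_add)
  then have adj: "support_adj E ?u = support_adj E ?v"
    by (simp add: support_adj_def support_def)
  have "(i, j) \<in> support_adj E ?v" "(j, i) \<in> support_adj E ?v"
    using E(2) by (auto simp: support_adj_def support_def lookup_add insert_commute)
  then have mem: "i \<in> component n E ?v k \<longleftrightarrow> j \<in> component n E ?v k" for k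
    using ij by (auto simp: component_def intro: rtrancl.rtrancl_into_rtrancl)
  have fin: "finite (component n E ?v k)" for k
    by (simp add: component_def)
  have "(\<Sum>u \<in> component n E ?u k. Poly_Mapping.lookup ?u (VX u)) =
      (\<Sum>u \<in> component n E ?v k. Poly_Mapping.lookup ?v (VX u))" for k
    using mem[of k] fin[of k] unfolding component_def[of n E ?u] adj component_def[of n E ?v, symmetric]
    by (simp add: lookup_add sum.distrib)
  then show ?thesis
    using deg by (simp add: monom_class_def mdeg_add)
qed

lemma coeff_sum_edge_ideal:
  assumes E: "simple_graph n E" and f: "f \<in> (edge_ideal n E :: 'k::field xypoly set)"
  shows "coeff_sum (\<lambda>m. monom_class n E m = c) f = 0"
proof -
  let ?P = "\<lambda>m. monom_class n E m = c"
  \<comment> \<open>Requiring all multiples to have sum zero makes \<open>?J\<close> an ideal; the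
    claim is the case \<open>g = 1\<close>.\<close>
  let ?J = "{f :: 'k xypoly. f \<in> carrier (S n) \<and> (\<forall>g. coeff_sum ?P (g * f) = 0)}"
  note edge = edge_ideal_generated[OF E, where ?'k = 'k]
  have "edge_ideal n E \<subseteq> ?J"
  proof (rule edge(3))
    show "ideal ?J (S n)"
      by (rule ideal_S_I)
        (auto simp: carrier_S_closed distrib_left coeff_sum_add mult.assoc[symmetric])
    show "binom i j \<in> ?J" if "{i, j} \<in> E" for i j
    proof -
      have "coeff_sum ?P (g * binom i j) = 0" for g :: "'k xypoly"
        unfolding binom_eq by (rule coeff_sum_mult_eq_0) (simp add: monom_class_edge[OF E that])
      then show ?thesis
        using edge(2)[OF that] ideal_S_closed(1)[OF edge(1)] by blast
    qed
  qed
  then have "coeff_sum ?P (1 * f) = 0"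
    using f by blast
  then show ?thesis by simp
qed

subsection \<open>Leading monomials of the edge ideal\<close>

text \<open>Each vertex after the first is the target of an \<open>R\<close>-step. The start is
  listed separately because the closure is reflexive.\<close>

lemma rtrancl_walk:
  assumes "(i, j) \<in> {(a, b). R a b}\<^sup>*"
  obtains P where "P \<noteq> []" "successively R P" "hd P = i" "last P = j"
    "set P \<subseteq> insert i {b. \<exists>a. R a b}"
  using assms
proof (induction arbitrary: thesis rule: rtrancl_induct)
  case base
  show ?case by (rule base[of "[i]"]) auto
next
  case (step j k)
  obtain P where "P \<noteq> []" "successively R P" "hd P = i" "last P = j"
    "set P \<subseteq> insert i {b. \<exists>a. R a b}"
    using step.IH by blast
  then show ?case
    using step.hyps(2) by (intro step.prems[of "P @ [k]"]) (auto simp: successively_append_iff)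
qed

text \<open>A strictly increasing index map into a sequence that is not longer is the identity:
  counting from the front gives \<open>i \<le> j i\<close>, counting from the back
  \<open>j i \<le> i\<close>.\<close>

lemma walk_le_same_length:
  assumes "walk_le Q P" "length P \<le> length Q" "P \<noteq> []" "Q \<noteq> []"
  shows "Q = P"
proof -
  obtain j :: "nat \<Rightarrow> nat" where j: "j 0 = 0" "j (length Q - 1) = length P - 1"
    "\<And>i. i + 1 < length Q \<Longrightarrow> j i < j (i + 1)" "\<And>i. i < length Q \<Longrightarrow> P ! j i = Q ! i"
    using assms(1) unfolding walk_le_def by auto
  have lower: "i \<le> j i" if "i < length Q" for i
    using that
  proof (induction i)
    case (Suc i)
    then show ?case using j(3)[of i] by simp
  qed simp
  have upper: "j (length Q - 1 - i) \<le> length P - 1 - i" if "i < length Q" for i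
    using that
  proof (induction i)
    case 0
    then show ?case using j(2) by simp
  next
    case (Suc i)
    then have *: "length Q - 1 - Suc i + 1 = length Q - 1 - i" "length Q - 1 - i < length Q"
      by simp_all
    have "j (length Q - 1 - Suc i) < j (length Q - 1 - i)"
      using j(3)[of "length Q - 1 - Suc i"] unfolding *(1) using *(2) by blast
    then show ?case using Suc by simp
  qed
  have "length Q = length P"
    using lower[of "length Q - 1"] j(2) assms(2,3,4) by (cases P; cases Q) auto
  moreover have "Q ! i = P ! i" if "i < length Q" for i
  proof -
    have "j i \<le> i"
      using upper[of "length Q - 1 - i"] that \<open>length Q = length P\<close> by simp
    then show ?thesis using lower[OF that] j(4)[OF that] by simp
  qed
  ultimately show ?thesis by (intro nth_equalityI) auto
qed

text \<open>A shortest walk in the support of \<open>m\<close> leading from an \<open>X\<close> to a \<open>Y\<close> at a larger vertex works: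
  any chord, repeated vertex, or joint violating irreducibility or divisibility would give a
  shorter one.\<close>

lemma exists_irreducible_path_dvd:
  assumes m: "Poly_Mapping.keys m \<subseteq> vars_upto n"
    and conn: "(i, k) \<in> (support_adj E m)\<^sup>*" and "i < k"
    and "Poly_Mapping.lookup m (VX i) > 0" "Poly_Mapping.lookup m (VY k) > 0"
  obtains P where "irreducible_path n E P" "monom_dvd (path_lead P) m"
proof -
  define good where "good P \<longleftrightarrow> P \<noteq> [] \<and> successively (\<lambda>a b. {a, b} \<in> E) P \<and>
    set P \<subseteq> support m \<and> hd P < last P \<and>
    Poly_Mapping.lookup m (VX (hd P)) > 0 \<and> Poly_Mapping.lookup m (VY (last P)) > 0" for P
  obtain P\<^sub>0 where P0: "P\<^sub>0 \<noteq> []" "successively (\<lambda>a b. {a, b} \<in> E \<and> a \<in> support m \<and> b \<in> support m) P\<^sub>0"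
      "hd P\<^sub>0 = i" "last P\<^sub>0 = k" "set P\<^sub>0 \<subseteq> insert i {b. \<exists>a. {a, b} \<in> E \<and> a \<in> support m \<and> b \<in> support m}"
    using conn unfolding support_adj_def by (rule rtrancl_walk)
  have "i \<in> support m" using assms(4) by (simp add: support_def)
  then have "good P\<^sub>0"
    using P0 assms unfolding good_def by (auto elim: successively_mono)
  then obtain P where P: "good P" and min: "\<And>Q. good Q \<Longrightarrow> length P \<le> length Q"
    using ex_has_least_nat[of good _ length] by blast
  have len: "length P \<ge> 2"
    using P unfolding good_def by (cases P rule: remdups_adj.cases) auto
  have supp: "support m \<subseteq> {1..n}"
  proof
    fix i assume "i \<in> support m"
    then have "VX i \<in> Poly_Mapping.keys m \<or> VY i \<in> Poly_Mapping.keys m"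
      by (auto simp: support_def in_keys_iff)
    then show "i \<in> {1..n}" using m by auto
  qed
  have dist: "distinct P"
  proof (rule ccontr)
    assume "\<not> distinct P"
    then obtain as y bs cs where eq: "P = as @ [y] @ bs @ [y] @ cs"
      using not_distinct_decomp by blast
    have "good (as @ [y] @ cs)"
      using P unfolding good_def eq
      by (auto simp: successively_append_iff successively_Cons hd_append)
    then show False using min[of "as @ [y] @ cs"] eq by simp
  qed
  have joint: "(p < hd P \<longrightarrow> Poly_Mapping.lookup m (VY p) > 0) \<and>
      (p > last P \<longrightarrow> Poly_Mapping.lookup m (VX p) > 0) \<and> \<not> (hd P < p \<and> p < last P)"
    if "p \<in> joints P" for p
  proof -
    obtain a xs b where eq: "P = a # xs @ [b]"
      using len list_length_ge_2_cases by blast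
    then have "p \<in> set xs" using that by simp
    then obtain us vs where xs: "xs = us @ p # vs"
      using split_list[of p xs] by blast
    \<comment> \<open>Both pieces of \<open>P\<close> cut at \<open>p\<close> are shorter, so
      neither is good: no \<open>Y\<close> at \<open>p\<close> if \<open>a < p\<close>, no
      \<open>X\<close> if \<open>p < b\<close>. As \<open>p\<close> is occupied, it is not between
      \<open>a\<close> and \<open>b\<close>, and its letter is forced.\<close>
    have "\<not> good (a # us @ [p])" "\<not> good (p # vs @ [b])"
      using min[of "a # us @ [p]"] min[of "p # vs @ [b]"] eq xs by auto
    moreover have "p \<in> support m" using P unfolding good_def eq xs by simp
    ultimately have "a < p \<Longrightarrow> Poly_Mapping.lookup m (VY p) = 0" "p < b \<Longrightarrow> Poly_Mapping.lookup m (VX p) = 0"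
        and "Poly_Mapping.lookup m (VX p) + Poly_Mapping.lookup m (VY p) > 0"
      using P unfolding good_def eq xs
      by (auto simp: successively_append_iff successively_Cons hd_append support_def split: if_splits)
    moreover have "a < b" using P unfolding good_def eq by simp
    ultimately show ?thesis
      unfolding eq by (cases "a < p"; cases "p < b") auto
  qed
  have walk: "walk n E P"
    using P supp unfolding good_def walk_iff by auto
  have "Q = P" if Q: "walk n E Q" "walk_le Q P" for Q
  proof (rule walk_le_same_length[OF Q(2)])
    obtain j :: "nat \<Rightarrow> nat" where j: "j 0 = 0" "j (length Q - 1) = length P - 1"
        "\<And>i. i + 1 < length Q \<Longrightarrow> j i < j (i + 1)" "\<And>i. i < length Q \<Longrightarrow> P ! j i = Q ! i"
      using Q(2) unfolding walk_le_def by auto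
    show ne: "Q \<noteq> []" "P \<noteq> []" using Q(1) P by (auto simp: walk_def good_def)
    have ends: "hd Q = hd P" "last Q = last P"
      using ne j(1,2) j(4)[of 0] j(4)[of "length Q - 1"] by (simp_all add: hd_conv_nth last_conv_nth)
    have le: "j i < length P" if "i < length Q" for i
    proof -
      have "i \<le> length Q - 1" using that by simp
      then have "j i \<le> j (length Q - 1)"
      proof (induction rule: inc_induct)
        case (step k)
        then have "j k < j (k + 1)" by (intro j(3)) simp
        then show ?case using step by simp
      qed simp
      also have "\<dots> < length P" using j(2) ne by simp
      finally show ?thesis .
    qed
    have "set Q \<subseteq> set P"
    proof
      fix q assume "q \<in> set Q"
      then obtain i where "i < length Q" "Q ! i = q" by (auto simp: in_set_conv_nth)
      then show "q \<in> set P"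
        using le[of i] j(4)[of i] nth_mem[of "j i" P] by simp
    qed
    \<comment> \<open>A walk below \<open>P\<close> has the same ends and no new vertices, so it is
      good and cannot be shorter.\<close>
    then have "good Q"
      using Q(1) P ends unfolding good_def walk_iff by auto
    then show "length P \<le> length Q" by (rule min)
  qed
  then have irr: "irreducible_path n E P"
    using dist len walk joint by (auto simp: irreducible_path_def is_path_def minimal_walk_def)
  have "Poly_Mapping.lookup m x > 0"
    if "x \<in> joint_var P ` joints P \<union> {VX (hd P), VY (last P)}" for x
    using that P joint irreducible_pathD(8)[OF irr] unfolding good_def
    by (force simp: joint_var_def)
  then have "monom_dvd (path_lead P) m"
    unfolding monom_dvd_iff lookup_path_lead[OF irr] by (auto simp: Suc_le_eq)
  with irr show ?thesis by (rule that)
qed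

lemma lead_monom_edge_ideal:
  assumes E: "simple_graph n E" and f: "f \<in> (edge_ideal n E :: 'k::field xypoly set)" "f \<noteq> 0"
  obtains P where "irreducible_path n E P" "monom_dvd (path_lead P) (lead_monom revlex_less f)"
proof -
  define m where "m = lead_monom revlex_less f"
  note lead = lead_monom_revlex[OF f(2), folded m_def]
  have f_S: "f \<in> carrier (S n)"
    using f(1) ideal_S_closed(1)[OF edge_ideal_generated(1)[OF E]] by blast
  \<comment> \<open>If \<open>m\<close> were alone in its class, the class sum would be its nonzero
    coefficient.\<close>
  have "\<exists>m' \<in> Poly_Mapping.keys f. m' \<noteq> m \<and> monom_class n E m' = monom_class n E m"
  proof (rule ccontr)
    assume "\<not> ?thesis"
    then have "coeff_sum (\<lambda>m'. monom_class n E m' = monom_class n E m) f =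
        (\<Sum>m' \<in> Poly_Mapping.keys f. if m' = m then Poly_Mapping.lookup f m else 0)"
      unfolding coeff_sum_def by (intro sum.cong) auto
    also have "\<dots> = Poly_Mapping.lookup f m"
      using lead(1) by simp
    finally show False
      using coeff_sum_edge_ideal[OF E f(1)] lead(1) by (simp add: in_keys_iff)
  qed
  then obtain m' where m': "m' \<in> Poly_Mapping.keys f" "revlex_less m' m"
    and cls: "monom_class n E m' = monom_class n E m"
    using lead(2) by blast
  have deg: "Poly_Mapping.lookup m' (VX i) + Poly_Mapping.lookup m' (VY i) =
      Poly_Mapping.lookup m (VX i) + Poly_Mapping.lookup m (VY i)" for i
    using arg_cong[OF cls, of "\<lambda>c. fst (snd c) i"] by (simp add: monom_class_def)
  have comp: "component n E m' v = component n E m v" for v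
    using deg by (simp add: component_def support_adj_def support_def)
  obtain x where x: "Poly_Mapping.lookup m x < Poly_Mapping.lookup m' x"
      "\<And>y. var_less y x \<Longrightarrow> Poly_Mapping.lookup m y = Poly_Mapping.lookup m' y"
    using m'(2) cls unfolding revlex_less_def monom_class_def by auto
  \<comment> \<open>If \<open>x\<close> were \<open>VY k\<close>, the exponents of the smaller
    \<open>VX k\<close> would agree, and the multidegree would force those of \<open>VY k\<close> to
    agree too.\<close>
  obtain k where k: "x = VX k"
  proof (cases x)
    case (VY k)
    then show ?thesis using x(1) x(2)[of "VX k"] deg[of k] by simp
  qed
  have "x \<in> Poly_Mapping.keys m'" using x(1) by (simp add: in_keys_iff)
  then have "k \<in> {1..n}"
    using f_S m'(1) k unfolding carrier_S by blast
  then have k_comp: "k \<in> component n E m k"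
    by (simp add: component_def)
  \<comment> \<open>\<open>m'\<close> has more \<open>X\<close> at \<open>k\<close> but the same
    total over the component, so it has fewer elsewhere.\<close>
  have "\<exists>i \<in> component n E m k. Poly_Mapping.lookup m' (VX i) < Poly_Mapping.lookup m (VX i)"
  proof (rule ccontr)
    assume "\<not> ?thesis"
    then have "(\<Sum>u \<in> component n E m k. Poly_Mapping.lookup m (VX u)) <
        (\<Sum>u \<in> component n E m k. Poly_Mapping.lookup m' (VX u))"
      using k_comp x(1) k by (intro sum_strict_mono_ex1) (auto simp: component_def not_less)
    moreover have "(\<Sum>u \<in> component n E m k. Poly_Mapping.lookup m (VX u)) =
        (\<Sum>u \<in> component n E m k. Poly_Mapping.lookup m' (VX u))"
      using arg_cong[OF cls, of "\<lambda>c. snd (snd c) k"] by (simp add: monom_class_def comp)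
    ultimately show False by simp
  qed
  then obtain i where i: "i \<in> component n E m k"
      "Poly_Mapping.lookup m' (VX i) < Poly_Mapping.lookup m (VX i)"
    by blast
  have "i \<noteq> k" using i(2) x(1) k by auto
  \<comment> \<open>For \<open>k < i\<close> the variable \<open>VX i\<close> is below
    \<open>VX k\<close>, where the exponents agree.\<close>
  moreover have "\<not> k < i" using i(2) x(2)[of "VX i"] k by auto
  ultimately have "i < k" by simp
  have "(i, k) \<in> (support_adj E m)\<^sup>*"
    using i(1) sym_rtrancl[OF sym_support_adj] by (auto simp: component_def dest: symD)
  moreover have "Poly_Mapping.lookup m (VY k) > 0"
    using x(1) deg[of k] k by simp
  moreover have "Poly_Mapping.keys m \<subseteq> vars_upto n"
    using f_S lead(1) unfolding carrier_S by blast
  ultimately obtain P where "irreducible_path n E P" "monom_dvd (path_lead P) m"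
    using exists_irreducible_path_dvd[of m n i k E] \<open>i < k\<close> i(2) by auto
  then show ?thesis unfolding m_def by (rule that)
qed

section \<open>The reduced Groebner basis\<close>

lemma finite_irreducible_paths: "finite {P. irreducible_path n E P}"
proof (rule finite_subset)
  show "{P. irreducible_path n E P} \<subseteq> {P. set P \<subseteq> {1..n} \<and> distinct P}"
    using irreducible_pathD by blast
qed (rule finite_subset_distinct, simp)

theorem theorem3p2:
  fixes n :: nat and E :: "nat set set"
  assumes "n \<ge> 1" and "simple_graph n E"
  shows "reduced_groebner_basis n revlex_less (edge_ideal n E :: 'k::field xypoly set)
           {path_poly P | P. irreducible_path n E P}"
proof -
  let ?I = "edge_ideal n E :: 'k xypoly set"
  let ?B = "{path_poly P | P. irreducible_path n E P} :: 'k xypoly set"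
  let ?lead = "\<lambda>F :: 'k xypoly set. {Poly_Mapping.single (lead_monom revlex_less f) 1 | f. f \<in> F \<and> f \<noteq> 0} :: 'k xypoly set"
  interpret R: ring "S n :: 'k xypoly ring" by (rule ring_S)
  note E = assms(2)
  have lead: "Poly_Mapping.keys (path_poly P :: 'k xypoly) = {path_lead P, path_trail P}"
      "lead_monom revlex_less (path_poly P :: 'k xypoly) = path_lead P"
      "Poly_Mapping.lookup (path_poly P :: 'k xypoly) (path_lead P) = 1"
    if "irreducible_path n E P" for P
    using path_poly_lead[OF irreducible_pathD(5)[OF that], where ?'k = 'k] by auto
  then have nz: "(path_poly P :: 'k xypoly) \<noteq> 0" if "irreducible_path n E P" for P
    using that by force
  have BI: "?B \<subseteq> ?I"
    using path_poly_mem_edge_ideal[OF E] by blast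
  have keys_I: "Poly_Mapping.keys (lead_monom revlex_less f) \<subseteq> vars_upto n" if "f \<in> ?I" "f \<noteq> 0" for f
  proof -
    have "f \<in> carrier (S n)"
      using that(1) ideal_S_closed(1)[OF edge_ideal_generated(1)[OF E]] by blast
    then show ?thesis
      using lead_monom_revlex(1)[OF that(2)] unfolding carrier_S by blast
  qed
  then have gens: "?lead ?I \<subseteq> carrier (S n)"
    using single_in_carrier_S by blast
  have lead_mono: "?lead ?B \<subseteq> ?lead ?I"
    using BI by blast
  have ideal_B: "ideal (Idl\<^bsub>S n\<^esub> (?lead ?B)) (S n)"
    using lead_mono gens by (intro R.genideal_ideal) blast
  have "Idl\<^bsub>S n\<^esub> (?lead ?B) \<subseteq> Idl\<^bsub>S n\<^esub> (?lead ?I)"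
    using R.genideal_self[OF gens] lead_mono by (intro R.genideal_minimal R.genideal_ideal gens) blast
  moreover have "Idl\<^bsub>S n\<^esub> (?lead ?I) \<subseteq> Idl\<^bsub>S n\<^esub> (?lead ?B)"
  proof (intro R.genideal_minimal ideal_B subsetI)
    fix g assume "g \<in> ?lead ?I"
    then obtain f where f: "f \<in> ?I" "f \<noteq> 0" and g: "g = Poly_Mapping.single (lead_monom revlex_less f) 1"
      by blast
    obtain P where P: "irreducible_path n E P" "monom_dvd (path_lead P) (lead_monom revlex_less f)"
      using lead_monom_edge_ideal[OF E f] by blast
    then obtain w where w: "lead_monom revlex_less f = path_lead P + w"
      unfolding monom_dvd_def by blast
    \<comment> \<open>The ideal absorbs only elements of \<open>S n\<close>, so the cofactor must
      use no variables outside it.\<close>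
    have "Poly_Mapping.keys w \<subseteq> Poly_Mapping.keys (lead_monom revlex_less f)"
      unfolding w by (auto simp: in_keys_iff lookup_add)
    then have "Poly_Mapping.single w 1 \<in> carrier (S n :: 'k xypoly ring)"
      using keys_I[OF f] by (intro single_in_carrier_S) blast
    moreover have "Poly_Mapping.single (path_lead P) 1 \<in> ?lead ?B"
      using P(1) lead(2) nz by force
    then have "Poly_Mapping.single (path_lead P) 1 \<in> Idl\<^bsub>S n\<^esub> (?lead ?B)"
      using R.genideal_self[of "?lead ?B"] lead_mono gens by blast
    ultimately have "Poly_Mapping.single w 1 * Poly_Mapping.single (path_lead P) 1 \<in> Idl\<^bsub>S n\<^esub> (?lead ?B)"
      by (rule ideal_S_closed(3)[OF ideal_B])
    then show "g \<in> Idl\<^bsub>S n\<^esub> (?lead ?B)"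
      by (simp add: g w mult_single add.commute)
  qed
  moreover have "finite ?B"
    using finite_irreducible_paths[of n E] by (simp add: setcompr_eq_image)
  ultimately have "groebner_basis n revlex_less ?I ?B"
    unfolding groebner_basis_def initial_ideal_def using BI nz by auto
  moreover have "Poly_Mapping.lookup g (lead_monom revlex_less g) = 1" if "g \<in> ?B" for g
    using that lead by auto
  moreover have "\<not> monom_dvd (lead_monom revlex_less h) m"
    if "g \<in> ?B" "h \<in> ?B" "h \<noteq> g" "m \<in> Poly_Mapping.keys g" for g h m
  proof -
    obtain P Q where "irreducible_path n E P" "g = path_poly P" "irreducible_path n E Q" "h = path_poly Q"
      using \<open>g \<in> ?B\<close> \<open>h \<in> ?B\<close> by blast
    then show ?thesis
      using path_poly_reduced[of n E P Q m, where ?'k = 'k] lead(2)[of Q] \<open>h \<noteq> g\<close> \<open>m \<in> _\<close> by metis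
  qed
  ultimately show ?thesis
    unfolding reduced_groebner_basis_def by blast
qed

end
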